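(* Let $c_h(\cdot,t)\in\Psi_h$, $0\le t\le T$, be a given approximation of the concentration, let $\bar c_h=\max(0,\min(c_h,1))$, and let the discrete porosity $\phi_h$ be defined pointwise in $x\in\Omega$ by $$\frac{\partial \phi_h}{\partial t}=\frac{\alpha\kappa}{\rho_s}(1-\phi_h)\,\bar c_h,\qquad \phi_h(x,0)=\phi_0(x).$$ Put $\eta=\frac{\alpha\kappa}{\rho_s}$, and let $\phi_0>0$. Then for any time $t\in(0,T]$ the approximate porosity $\phi_h$ is bounded, that is, $$\phi_0\le \phi_h\le 1-(1-\phi_0)e^{-\eta t}<1,$$ $$0\le \frac{\partial\phi_h}{\partial t}\le\frac{\alpha\kappa}{\rho_s}.$$
   Context: $\Omega\subset\mathbb{R}^d$ ($d=2,3$) is a bounded polygonal/polyhedral domain and $T>0$. $\mathcal{T}_h$ is a partition of $\Omega$ into elements $K$, and $\Psi_h$ is the space of functions on $\Omega$ whose restriction to each $K\in\mathcal{T}_h$ is a polynomial of degree at most $k$. The constants $\alpha,\rho_s,k_c,k_s$ are positive; $\phi_0$ is the initial porosity, with $0<\phi_0(x)<1$; $a_0>0$ is the initial interfacial area; and $$\kappa=\frac{k_ck_sa_0}{(k_c+k_s)(1-\phi_0)}.$$ All inequalities are pointwise in $x$. *)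

theory Defs
  imports "HOL-Analysis.Analysis"
begin

definition polyhedral_domain :: "(real ^ 'n) set \<Rightarrow> bool" where
  "polyhedral_domain \<Omega> \<longleftrightarrow>
     \<Omega> \<noteq> {} \<and> open \<Omega> \<and> connected \<Omega> \<and> bounded \<Omega> \<and>
     (\<exists>\<F>. finite \<F> \<and> (\<forall>F\<in>\<F>. polytope F \<and> aff_dim F = int CARD('n) - 1) \<and>
          frontier \<Omega> = \<Union>\<F>)"

text \<open>
  An element may contain all, some or none of its boundary points, so this covers open elements,
  closed elements, and elements forming a disjoint partition in the set-theoretic sense.
  With closed elements, functions in the space \<open>broken_poly_space\<close> below are continuous
  across element faces; with open or disjoint elements they may jump.
\<close>

definition is_mesh :: "(real ^ 'n) set \<Rightarrow> (real ^ 'n) set set \<Rightarrow> bool" where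
  "is_mesh \<Omega> \<T> \<longleftrightarrow>
     finite \<T> \<and>
     (\<forall>K\<in>\<T>. polyhedral_domain (interior K) \<and> interior K \<subseteq> \<Omega> \<and> K \<subseteq> closure (interior K)) \<and>
     (\<forall>K\<in>\<T>. \<forall>L\<in>\<T>. K \<noteq> L \<longrightarrow> interior K \<inter> interior L = {}) \<and>
     closure \<Omega> = (\<Union>K\<in>\<T>. closure K)"

text \<open>Polynomials of total degree at most \<open>k\<close>; \<open>m\<close> ranges over the multi-indices.\<close>

definition poly_fun_deg_le :: "nat \<Rightarrow> (real ^ 'n \<Rightarrow> real) \<Rightarrow> bool" where
  "poly_fun_deg_le k p \<longleftrightarrow>
     (\<exists>a :: ('n \<Rightarrow> nat) \<Rightarrow> real.
        \<forall>x. p x = (\<Sum>m | (\<Sum>i\<in>UNIV. m i) \<le> k. a m * (\<Prod>i\<in>UNIV. (x $ i) ^ m i)))"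

text \<open>
  The space \<open>\<Psi>\<^sub>h\<close>. Functions on \<open>\<Omega>\<close> are represented by total functions
  whose values outside \<open>\<Omega>\<close> are irrelevant.
\<close>

definition broken_poly_space ::
    "nat \<Rightarrow> (real ^ 'n) set \<Rightarrow> (real ^ 'n) set set \<Rightarrow> (real ^ 'n \<Rightarrow> real) set" where
  "broken_poly_space k \<Omega> \<T> =
     {f. \<forall>K\<in>\<T>. \<exists>p. poly_fun_deg_le k p \<and> (\<forall>x\<in>K \<inter> \<Omega>. f x = p x)}"

definition reaction_coeff ::
    "real \<Rightarrow> real \<Rightarrow> ('a \<Rightarrow> real) \<Rightarrow> ('a \<Rightarrow> real) \<Rightarrow> 'a \<Rightarrow> real" where
  "reaction_coeff k\<^sub>c k\<^sub>s a\<^sub>0 \<phi>\<^sub>0 x = k\<^sub>c * k\<^sub>s * a\<^sub>0 x / ((k\<^sub>c + k\<^sub>s) * (1 - \<phi>\<^sub>0 x))"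

definition cutoff :: "real \<Rightarrow> real" where
  "cutoff c = max 0 (min c 1)"

text \<open>
  The time derivative is one-sided at \<open>0\<close> and \<open>T\<close>. No regularity of \<open>c\<close> in time
  is imposed beyond what the existence of a classical solution \<open>\<phi>\<close> entails.
\<close>

definition discrete_porosity ::
    "'a set \<Rightarrow> real \<Rightarrow> real \<Rightarrow> real \<Rightarrow> ('a \<Rightarrow> real) \<Rightarrow> ('a \<Rightarrow> real) \<Rightarrow>
     ('a \<Rightarrow> real \<Rightarrow> real) \<Rightarrow> ('a \<Rightarrow> real \<Rightarrow> real) \<Rightarrow> bool" where
  "discrete_porosity \<Omega> T \<alpha> \<rho>\<^sub>s \<kappa> \<phi>\<^sub>0 c \<phi> \<longleftrightarrow>
     (\<forall>x\<in>\<Omega>. \<phi> x 0 = \<phi>\<^sub>0 x \<and>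
        (\<forall>t\<in>{0..T}. (\<phi> x has_real_derivative
            \<alpha> * \<kappa> x / \<rho>\<^sub>s * (1 - \<phi> x t) * cutoff (c x t)) (at t within {0..T})))"

end

theory Submission
  imports Defs
begin

text \<open>
  The solid fraction \<open>w = 1 - \<phi>\<close> solves \<open>w' = - \<eta> g w\<close> with \<open>0 \<le> g \<le> 1\<close>. Since \<open>w\<^sup>2\<close> is
  nonincreasing, \<open>w\<close> cannot leave \<open>0\<close> once it has reached it, so it stays nonnegative without any
  regularity of \<open>g\<close> in time. Then \<open>w\<close> is nonincreasing and \<open>w e\<^bsup>\<eta>t\<^esup>\<close> is nondecreasing.
\<close>

text \<open>The derivative is taken within \<open>{a..b}\<close>, so it is one-sided at the
  endpoints, as in \<open>discrete_porosity\<close>. It restricts to the subinterval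
  \<open>{s..t}\<close>, where the mean value theorem gives the claim.\<close>

lemma has_real_derivative_within_nonneg_imp_le:
  fixes f f' :: "real \<Rightarrow> real"
  assumes der: "\<And>t. t \<in> {a..b} \<Longrightarrow> (f has_real_derivative f' t) (at t within {a..b})"
    and nonneg: "\<And>t. t \<in> {a..b} \<Longrightarrow> 0 \<le> f' t"
    and "s \<le> t" "s \<in> {a..b}" "t \<in> {a..b}"
  shows "f s \<le> f t"
proof -
  have "(f has_derivative (*) (f' u)) (at u within {s..t})" if "u \<in> {s..t}" for u
  proof -
    have "(f has_real_derivative f' u) (at u within {s..t})"
      using der[of u] that assms(4,5) by (auto intro: DERIV_subset)
    then show ?thesis
      by (simp add: has_field_derivative_def)
  qed
  from mvt_very_simple[OF \<open>s \<le> t\<close> this]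
  obtain u where u: "u \<in> {s..t}" "f t - f s = f' u * (t - s)"
    by auto
  then have "0 \<le> f' u * (t - s)"
    using assms(3-5) nonneg[of u] by (intro mult_nonneg_nonneg) auto
  with u show ?thesis
    by simp
qed

lemma linear_decay_nonneg:
  fixes w r :: "real \<Rightarrow> real"
  assumes der: "\<And>t. t \<in> {0..T} \<Longrightarrow> (w has_real_derivative - r t * w t) (at t within {0..T})"
    and r: "\<And>t. t \<in> {0..T} \<Longrightarrow> 0 \<le> r t"
    and w0: "0 \<le> w 0" and t: "t \<in> {0..T}"
  shows "0 \<le> w t"
proof (rule ccontr)
  assume neg: "\<not> 0 \<le> w t"
  have "continuous_on {0..T} w"
    using der by (rule DERIV_continuous_on)
  then have "continuous_on {0..t} w"
    by (rule continuous_on_subset) (use t in auto)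
  \<comment> \<open>By the intermediate value theorem, a sign change before \<open>t\<close> forces
    a zero \<open>s\<close>, from which \<open>w\<close> would have to depart again.\<close>
  then obtain s where s: "0 \<le> s" "s \<le> t" "w s = 0"
    using IVT2'[of w t 0 0] neg w0 t by auto
  \<comment> \<open>The derivative of the square is \<open>- 2 * r u * (w u)\<^sup>2\<close>, whose
    sign is known before that of \<open>w\<close> is. The negation turns decrease into the increase
    that the monotonicity lemma treats.\<close>
  have "- (w s)\<^sup>2 \<le> - (w t)\<^sup>2"
  proof (rule has_real_derivative_within_nonneg_imp_le[where f = "\<lambda>u. - (w u)\<^sup>2"])
    fix u assume u: "u \<in> {0..T}"
    show "((\<lambda>u. - (w u)\<^sup>2) has_real_derivative 2 * r u * (w u)\<^sup>2) (at u within {0..T})"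
      by (rule derivative_eq_intros der[OF u] refl)+ (simp add: power2_eq_square)
    show "0 \<le> 2 * r u * (w u)\<^sup>2"
      using r[OF u] by simp
  qed (use s t in auto)
  with s neg show False
    by simp
qed

text \<open>The two bounds are the exact solutions for the extreme rates \<open>g = 0\<close> and
  \<open>g = 1\<close>; any rate in between keeps \<open>w\<close> between them.\<close>

lemma linear_decay_bounds:
  fixes w g :: "real \<Rightarrow> real"
  assumes der: "\<And>t. t \<in> {0..T} \<Longrightarrow> (w has_real_derivative - (\<eta> * g t) * w t) (at t within {0..T})"
    and g: "\<And>t. t \<in> {0..T} \<Longrightarrow> 0 \<le> g t \<and> g t \<le> 1"
    and \<eta>: "0 \<le> \<eta>" and w0: "0 \<le> w 0" and t: "t \<in> {0..T}"
  shows "w t \<le> w 0" and "w 0 * exp (- \<eta> * t) \<le> w t"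
proof -
  have nonneg: "0 \<le> w u" if "u \<in> {0..T}" for u
    using linear_decay_nonneg[OF der _ w0 that] g \<eta> by simp
  have "- w 0 \<le> - w t"
  proof (rule has_real_derivative_within_nonneg_imp_le[where f = "\<lambda>u. - w u"])
    fix u assume u: "u \<in> {0..T}"
    show "((\<lambda>u. - w u) has_real_derivative \<eta> * g u * w u) (at u within {0..T})"
      by (rule derivative_eq_intros der[OF u])+ simp
    show "0 \<le> \<eta> * g u * w u"
      using g[OF u] \<eta> nonneg[OF u] by simp
  qed (use t in auto)
  then show "w t \<le> w 0"
    by simp
  \<comment> \<open>The exponential is the integrating factor for \<open>g = 1\<close>. What remains
    of the derivative carries the factor \<open>1 - g u\<close>, nonnegative because
    \<open>g u \<le> 1\<close>.\<close>
  have "w 0 * exp (\<eta> * 0) \<le> w t * exp (\<eta> * t)"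
  proof (rule has_real_derivative_within_nonneg_imp_le[where f = "\<lambda>u. w u * exp (\<eta> * u)"])
    fix u assume u: "u \<in> {0..T}"
    show "((\<lambda>u. w u * exp (\<eta> * u)) has_real_derivative \<eta> * (1 - g u) * w u * exp (\<eta> * u))
        (at u within {0..T})"
      by (rule derivative_eq_intros der[OF u] refl)+ (simp add: algebra_simps)
    show "0 \<le> \<eta> * (1 - g u) * w u * exp (\<eta> * u)"
      using g[OF u] \<eta> nonneg[OF u] by simp
  qed (use t in auto)
  then show "w 0 * exp (- \<eta> * t) \<le> w t"
    by (simp add: exp_minus field_simps)
qed

theorem theorem2p2:
  fixes \<Omega> :: "(real ^ 'n) set"
    and \<T> :: "(real ^ 'n) set set"
    and k :: nat
    and T \<alpha> \<rho>\<^sub>s k\<^sub>c k\<^sub>s :: real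
    and \<phi>\<^sub>0 a\<^sub>0 \<kappa> \<eta> :: "real ^ 'n \<Rightarrow> real"
    and c\<^sub>h \<phi>\<^sub>h :: "real ^ 'n \<Rightarrow> real \<Rightarrow> real"
  assumes "CARD('n) = 2 \<or> CARD('n) = 3"
    and "polyhedral_domain \<Omega>"
    and "is_mesh \<Omega> \<T>"
    and "T > 0"
    and "\<alpha> > 0" and "\<rho>\<^sub>s > 0" and "k\<^sub>c > 0" and "k\<^sub>s > 0"
    and "\<And>x. x \<in> \<Omega> \<Longrightarrow> 0 < \<phi>\<^sub>0 x \<and> \<phi>\<^sub>0 x < 1"
    and "\<And>x. x \<in> \<Omega> \<Longrightarrow> a\<^sub>0 x > 0"
    and "\<And>x. x \<in> \<Omega> \<Longrightarrow> \<kappa> x = reaction_coeff k\<^sub>c k\<^sub>s a\<^sub>0 \<phi>\<^sub>0 x"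
    and "\<And>x. x \<in> \<Omega> \<Longrightarrow> \<eta> x = \<alpha> * \<kappa> x / \<rho>\<^sub>s"
    and "\<And>t. t \<in> {0..T} \<Longrightarrow> (\<lambda>x. c\<^sub>h x t) \<in> broken_poly_space k \<Omega> \<T>"
    and "discrete_porosity \<Omega> T \<alpha> \<rho>\<^sub>s \<kappa> \<phi>\<^sub>0 c\<^sub>h \<phi>\<^sub>h"
  shows "\<forall>t\<in>{0<..T}. \<forall>x\<in>\<Omega>.
      \<phi>\<^sub>0 x \<le> \<phi>\<^sub>h x t \<and>
      \<phi>\<^sub>h x t \<le> 1 - (1 - \<phi>\<^sub>0 x) * exp (- \<eta> x * t) \<and>
      1 - (1 - \<phi>\<^sub>0 x) * exp (- \<eta> x * t) < 1 \<and>
      0 \<le> vector_derivative (\<phi>\<^sub>h x) (at t within {0..T}) \<and>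
      vector_derivative (\<phi>\<^sub>h x) (at t within {0..T}) \<le> \<alpha> * \<kappa> x / \<rho>\<^sub>s"
proof (intro ballI)
  fix t x assume t: "t \<in> {0<..T}" and x: "x \<in> \<Omega>"
  define g where "g u = cutoff (c\<^sub>h x u)" for u
  have g: "0 \<le> g u \<and> g u \<le> 1" for u
    by (auto simp: g_def cutoff_def)
  have \<phi>0: "0 < \<phi>\<^sub>0 x" "\<phi>\<^sub>0 x < 1"
    using assms(9)[OF x] by auto
  have \<eta>: "0 \<le> \<eta> x"
    using assms(5-8) assms(10-12)[OF x] \<phi>0 by (simp add: reaction_coeff_def)
  have init: "\<phi>\<^sub>h x 0 = \<phi>\<^sub>0 x"
    and der: "(\<phi>\<^sub>h x has_real_derivative \<eta> x * (1 - \<phi>\<^sub>h x u) * g u) (at u within {0..T})"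
      if "u \<in> {0..T}" for u
    using assms(14) assms(12)[OF x] x that by (auto simp: discrete_porosity_def g_def)
  have der': "((\<lambda>u. 1 - \<phi>\<^sub>h x u) has_real_derivative - (\<eta> x * g u) * (1 - \<phi>\<^sub>h x u))
      (at u within {0..T})" if "u \<in> {0..T}" for u
    by (rule derivative_eq_intros der[OF that] refl)+ (simp add: algebra_simps)
  have tT: "t \<in> {0..T}" and init: "\<phi>\<^sub>h x 0 = \<phi>\<^sub>0 x"
    using t init[of 0] by auto
  \<comment> \<open>Passing from \<open>w = 1 - \<phi>\<^sub>h x\<close> back to the porosity swaps
    the bounds: the upper bound on \<open>w\<close> becomes \<open>lower\<close>, and the
    exponential lower bound becomes \<open>upper\<close>.\<close>
  have lower: "\<phi>\<^sub>0 x \<le> \<phi>\<^sub>h x t"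
    and upper: "(1 - \<phi>\<^sub>0 x) * exp (- \<eta> x * t) \<le> 1 - \<phi>\<^sub>h x t"
    using linear_decay_bounds[OF der' g \<eta> _ tT] \<phi>0 init by auto
  have pos: "0 < (1 - \<phi>\<^sub>0 x) * exp (- \<eta> x * t)"
    using \<phi>0 by simp
  \<comment> \<open>Since \<open>T > 0\<close>, the interval is nondegenerate and the derivative
    within it is unique, also at \<open>t = T\<close>, so \<open>vector_derivative\<close> takes the
    value given by the equation.\<close>
  have vd: "vector_derivative (\<phi>\<^sub>h x) (at t within {0..T}) = \<eta> x * (1 - \<phi>\<^sub>h x t) * g t"
    using der[OF tT] tT \<open>T > 0\<close>
    by (intro vector_derivative_within_closed_interval)
      (auto simp: has_real_derivative_iff_has_vector_derivative)
  \<comment> \<open>By \<open>lower\<close>, the first factor is at most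
    \<open>1 - \<phi>\<^sub>0 x < 1\<close>, and \<open>g t\<close> lies in the unit
    interval.\<close>
  have "(1 - \<phi>\<^sub>h x t) * g t \<le> 1"
    using g[of t] lower upper pos \<phi>0 by (intro mult_le_one) auto
  then have "\<eta> x * ((1 - \<phi>\<^sub>h x t) * g t) \<le> \<eta> x"
    using \<eta> by (rule mult_left_le)
  \<comment> \<open>Here \<open>upper\<close> and \<open>pos\<close> make
    \<open>1 - \<phi>\<^sub>h x t\<close> positive.\<close>
  moreover have "0 \<le> \<eta> x * (1 - \<phi>\<^sub>h x t) * g t"
    using \<eta> g[of t] upper pos by simp
  ultimately show "\<phi>\<^sub>0 x \<le> \<phi>\<^sub>h x t \<and>
      \<phi>\<^sub>h x t \<le> 1 - (1 - \<phi>\<^sub>0 x) * exp (- \<eta> x * t) \<and>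
      1 - (1 - \<phi>\<^sub>0 x) * exp (- \<eta> x * t) < 1 \<and>
      0 \<le> vector_derivative (\<phi>\<^sub>h x) (at t within {0..T}) \<and>
      vector_derivative (\<phi>\<^sub>h x) (at t within {0..T}) \<le> \<alpha> * \<kappa> x / \<rho>\<^sub>s"
    using lower upper pos vd assms(12)[OF x] by (simp add: mult.assoc)
qed

end
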